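(* Let $k\ge 1$ and $n\ge 0$ be integers. The $k+1$ statistics $\mathrm{pk}_0,\mathrm{pk}_1,\dots,\mathrm{pk}_{k-1},\mathrm{dd}$ are equidistributed on $\mathcal{P}^k_n$; that is, for every integer $r\ge 0$, the number of $P\in\mathcal{P}^k_n$ with $\mathrm{st}(P)=r$ is the same for every $\mathrm{st}\in\{\mathrm{pk}_0,\dots,\mathrm{pk}_{k-1},\mathrm{dd}\}$.
   Context: A $k$-Dyck path of down-size $n$ is a lattice path from $(0,0)$ to $((k+1)n,0)$ with steps $u=(1,1)$ and $d=(1,-k)$ that stays in the first quadrant (never goes below the $x$-axis). $\mathcal{P}^k_n$ is the set of all such paths. A peak is a block of two consecutive steps $ud$; its height is the second coordinate of the left endpoint of its $d$ step. A double descent is a block $dd$ of two consecutive steps. For $0\le i\le k-1$, $\mathrm{pk}_i(P)$ is the number of non-rightmost peaks of $P$ (all peaks except the last one) whose height is congruent to $i$ modulo $k$; $\mathrm{dd}(P)$ is the number of double descents of $P$. All statistics are $0$ on the empty path ($n=0$). *)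

theory Defs
  imports "HOL-Library.Product_Plus" "HOL-Number_Theory.Cong"
begin

text \<open>A lattice path is represented by its list of steps, starting at the origin.\<close>

datatype step = U | D

fun step_vec :: "nat \<Rightarrow> step \<Rightarrow> int \<times> int" where
  "step_vec k U = (1, 1)"
| "step_vec k D = (1, - int k)"

definition vertex :: "nat \<Rightarrow> step list \<Rightarrow> nat \<Rightarrow> int \<times> int" where
  "vertex k P i = sum_list (map (step_vec k) (take i P))"

definition dyck_paths :: "nat \<Rightarrow> nat \<Rightarrow> step list set" where
  "dyck_paths k n =
     {P. vertex k P (length P) = (int ((k + 1) * n), 0) \<and>
         (\<forall>i \<le> length P. fst (vertex k P i) \<ge> 0 \<and> snd (vertex k P i) \<ge> 0)}"

text \<open>A peak or double descent is identified with the (0-based) position of its first step,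
  so the left endpoint of the \<open>D\<close> step of the peak at position \<open>i\<close> is vertex \<open>Suc i\<close>.\<close>

definition peaks :: "step list \<Rightarrow> nat set" where
  "peaks P = {i. Suc i < length P \<and> P ! i = U \<and> P ! Suc i = D}"

definition peak_height :: "nat \<Rightarrow> step list \<Rightarrow> nat \<Rightarrow> int" where
  "peak_height k P i = snd (vertex k P (Suc i))"

definition pk :: "nat \<Rightarrow> nat \<Rightarrow> step list \<Rightarrow> nat" where
  "pk k j P =
     card {i \<in> peaks P. (\<exists>i' \<in> peaks P. i < i') \<and> [peak_height k P i = int j] (mod int k)}"

definition dd :: "step list \<Rightarrow> nat" where
  "dd P = card {i. Suc i < length P \<and> P ! i = D \<and> P ! Suc i = D}"

text \<open>Cardinalities of sets of paths are genuine: there are only finitely many paths.\<close>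

lemma fst_sum_list_step_vec: "fst (sum_list (map (step_vec k) P)) = int (length P)"
proof (induction P)
  case (Cons s P)
  then show ?case by (cases s) simp_all
qed simp

lemma finite_dyck_paths: "finite (dyck_paths k n)"
proof (rule finite_subset)
  have fin: "finite (UNIV :: step set)"
    by (rule finite_subset[of _ "{U, D}"]) (auto intro: step.exhaust)
  show "finite {P :: step list. set P \<subseteq> UNIV \<and> length P = (k + 1) * n}"
    by (rule finite_lists_length_eq[OF fin])
  have "length P = (k + 1) * n" if "P \<in> dyck_paths k n" for P
  proof -
    have "sum_list (map (step_vec k) P) = (int ((k + 1) * n), 0)"
      using that by (simp add: dyck_paths_def vertex_def)
    then have "int (length P) = int ((k + 1) * n)"
      using fst_sum_list_step_vec[of k P] by (metis fst_conv)
    then show ?thesis by (simp only: of_nat_eq_iff)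
  qed
  then show "dyck_paths k n \<subseteq> {P. set P \<subseteq> UNIV \<and> length P = (k + 1) * n}"
    by blast
qed

end

theory Submission
  imports Defs "HOL-Combinatorics.Transposition"
begin

text \<open>Every nonempty path factors uniquely as
  \<open>P = Q\<^sub>0 U Q\<^sub>1 U \<dots> U Q\<^sub>k D\<close> with \<open>k\<close>-Dyck paths \<open>Q\<^sub>j\<close>, so paths correspond to trees in
  which every inner node has \<open>k + 1\<close> children. Precisely, \<open>U P\<close> is the postfix word of the tree, and a
  stack machine recovers the tree from it (\<open>bij_betw_tl_post\<close>).

  In these terms \<open>dd P\<close> is the sum of the \<open>dd Q\<^sub>j\<close>, plus one if \<open>Q\<^sub>k\<close> is nonempty. For a residue
  \<open>i\<close> modulo \<open>k\<close>, let \<open>T\<^sub>i P\<close> be the number of all peaks of \<open>P\<close> with height congruent to \<open>i\<close>.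
  As \<open>Q\<^sub>j\<close> starts at height \<open>j\<close>, it is the sum of the \<open>T\<^sub>i\<^sub>-\<^sub>j Q\<^sub>j\<close>, plus one if \<open>Q\<^sub>k\<close> is empty and
  \<open>i = 0\<close>. The last peak of a path has height divisible by \<open>k\<close>, so on nonempty paths \<open>pk\<^sub>i\<close> is
  \<open>T\<^sub>i - [i = 0]\<close> (\<open>pk_eq_occ_minus\<close>).

  The bijection \<open>psi\<close> with parameter \<open>i\<close> exchanges the children with numbers \<open>i\<close> and \<open>k\<close> of the root
  and then acts on the child now in position \<open>j\<close> with parameter \<open>i - j\<close>. Inductively the child
  in position \<open>j\<close> contributes its former number of double descents to \<open>T\<^sub>i\<close>, and one more if
  \<open>j\<close> is congruent to \<open>i\<close> and the child is nonempty. In position \<open>j = i\<close> sits the former last child,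
  whose nonemptiness is exactly what \<open>dd\<close> records at the root. If \<open>i = 0\<close>, position \<open>k\<close> yields exactly one
  further peak, from the child there if it is nonempty and from the final \<open>D\<close> otherwise. Hence \<open>T\<^sub>i\<close> of the image is
  \<open>dd + [i = 0]\<close> on nonempty paths (\<open>tree_pk_psi\<close>), and \<open>pk\<^sub>i\<close> of the image is \<open>dd\<close>.\<close>

section \<open>Heights and counting consecutive pairs of steps\<close>

text \<open>The height reached by a path that starts at height 0.\<close>

definition ht :: "nat \<Rightarrow> step list \<Rightarrow> int" where
  "ht k w = snd (sum_list (map (step_vec k) w))"

lemma ht_Nil [simp]: "ht k [] = 0"
  by (simp add: ht_def)

lemma ht_Cons: "ht k (s # w) = ht k [s] + ht k w"
  by (simp add: ht_def)

lemma ht_U [simp]: "ht k (U # w) = 1 + ht k w"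
  by (simp add: ht_def)

lemma ht_D [simp]: "ht k (D # w) = ht k w - int k"
  by (simp add: ht_def)

lemma ht_append [simp]: "ht k (v @ w) = ht k v + ht k w"
  by (simp add: ht_def)

lemma ht_replicate_D: "ht k (replicate m D) = - int (k * m)"
  by (induction m) (simp_all add: algebra_simps)

lemma dyck_paths_iff:
  "P \<in> dyck_paths k n \<longleftrightarrow>
     length P = (k + 1) * n \<and> ht k P = 0 \<and> (\<forall>i \<le> length P. ht k (take i P) \<ge> 0)"
proof -
  have "vertex k P i = (int (length (take i P)), ht k (take i P))" for i
    unfolding vertex_def ht_def by (metis fst_sum_list_step_vec prod.collapse)
  then show ?thesis
    unfolding dyck_paths_def by (auto simp del: of_nat_mult of_nat_add)
qed

text \<open>The number of occurrences of the two consecutive steps \<open>a\<close>, \<open>b\<close> in \<open>w\<close> for which the height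
  between the two steps satisfies \<open>R\<close>.\<close>

definition occ :: "nat \<Rightarrow> step \<Rightarrow> step \<Rightarrow> (int \<Rightarrow> bool) \<Rightarrow> step list \<Rightarrow> nat" where
  "occ k a b R w =
     card {i. Suc i < length w \<and> w ! i = a \<and> w ! Suc i = b \<and> R (ht k (take (Suc i) w))}"

lemma occ_Nil [simp]: "occ k a b R [] = 0"
  by (simp add: occ_def)

lemma occ_Cons:
  "occ k a b R (x # w) =
     of_bool (x = a \<and> w \<noteq> [] \<and> hd w = b \<and> R (ht k [x])) + occ k a b (\<lambda>y. R (ht k [x] + y)) w"
proof -
  let ?A = "{i. Suc i < length (x # w) \<and> (x # w) ! i = a \<and> (x # w) ! Suc i = b
               \<and> R (ht k (take (Suc i) (x # w)))}"
  let ?B = "{i. Suc i < length w \<and> w ! i = a \<and> w ! Suc i = b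
               \<and> R (ht k [x] + ht k (take (Suc i) w))}"
  let ?c = "x = a \<and> w \<noteq> [] \<and> hd w = b \<and> R (ht k [x])"
  have mem: "i \<in> ?A \<longleftrightarrow> i \<in> {j. j = 0 \<and> ?c} \<union> Suc ` ?B" for i
  proof (cases i)
    case 0
    then show ?thesis by (cases w) auto
  next
    case (Suc j)
    then show ?thesis by (auto simp: ht_Cons[of k x "take (Suc j) w"])
  qed
  then have "?A = {j. j = 0 \<and> ?c} \<union> Suc ` ?B"
    by blast
  moreover have "finite ?B"
    by (rule finite_subset[of _ "{..<length w}"]) auto
  ultimately have "card ?A = card {j::nat. j = 0 \<and> ?c} + card (Suc ` ?B)"
    by (simp only:) (intro card_Un_disjoint; auto)
  moreover have "card {j::nat. j = 0 \<and> ?c} = of_bool ?c"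
    by (cases ?c) auto
  moreover have "card (Suc ` ?B) = card ?B"
    by (simp add: card_image)
  ultimately show ?thesis
    unfolding occ_def by presburger
qed

lemma occ_append:
  "occ k a b R (v @ w) =
     occ k a b R v + occ k a b (\<lambda>y. R (ht k v + y)) w
       + of_bool (v \<noteq> [] \<and> last v = a \<and> w \<noteq> [] \<and> hd w = b \<and> R (ht k v))"
proof (induction v arbitrary: R)
  case (Cons x v)
  show ?case
  proof (cases "v = []")
    case True
    then show ?thesis by (simp add: occ_Cons)
  next
    case False
    then show ?thesis
      using Cons.IH[of "\<lambda>y. R (ht k [x] + y)"]
      by (simp add: occ_Cons[of k a b _ x] ht_Cons[of k x v] add.assoc del: ht_U ht_D)
  qed
qed simp

lemma dd_eq_occ: "dd P = occ k D D (\<lambda>_. True) P"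
  by (simp add: dd_def occ_def)

section \<open>Paths as postfix words of trees\<close>

text \<open>Plane trees; those in which every inner node has exactly \<open>k + 1\<close> children are singled out
  by \<open>kary k\<close>.\<close>

datatype tree = Leaf | Node "tree list"

primrec kary :: "nat \<Rightarrow> tree \<Rightarrow> bool" where
  "kary k Leaf \<longleftrightarrow> True"
| "kary k (Node ts) \<longleftrightarrow> length ts = Suc k \<and> list_all id (map (kary k) ts)"

lemma kary_Node [simp]:
  "kary k (Node ts) \<longleftrightarrow> length ts = Suc k \<and> (\<forall>t \<in> set ts. kary k t)"
  by (simp add: list_all_iff)

declare kary.simps(2) [simp del]

text \<open>Postfix notation: \<open>U\<close> stands for a leaf and \<open>D\<close> for the node formed by the preceding
  \<open>k + 1\<close> trees. Dropping the initial \<open>U\<close> gives the path of the tree.\<close>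

primrec post :: "tree \<Rightarrow> step list" where
  "post Leaf = [U]"
| "post (Node ts) = concat (map post ts) @ [D]"

lemma post_neq_Nil [simp]: "post t \<noteq> []"
  by (cases t) simp_all

lemma last_post: "last (post t) = (if t = Leaf then U else D)"
  by (cases t) simp_all

lemma hd_concat_post: "ts \<noteq> [] \<Longrightarrow> hd (concat (map post ts)) = hd (post (hd ts))"
  by (cases ts) simp_all

lemma concat_post_eq_Nil [simp]: "concat (map post ts) = [] \<longleftrightarrow> ts = []"
  by (cases ts) simp_all

lemma last_concat_post: "ts \<noteq> [] \<Longrightarrow> last (concat (map post ts)) = last (post (last ts))"
  by (induction ts rule: rev_induct) simp_all

lemma hd_post: "kary k t \<Longrightarrow> hd (post t) = U"
proof (induction t)
  case (Node ts)
  then have "ts \<noteq> []" by auto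
  then show ?case using Node by (simp add: hd_concat_post)
qed simp

lemma ht_concat:
  "(\<And>w. w \<in> set ws \<Longrightarrow> ht k w = 1) \<Longrightarrow> ht k (concat ws) = int (length ws)"
  by (induction ws) simp_all

lemma ht_post: "kary k t \<Longrightarrow> ht k (post t) = 1"
proof (induction t)
  case (Node ts)
  then have "ht k (concat (map post ts)) = int (length (map post ts))"
    by (intro ht_concat) auto
  then show ?case using Node.prems by simp
qed simp

lemma ht_concat_prefix:
  assumes "\<And>w. w \<in> set ws \<Longrightarrow> ht k w = 1"
    and "\<And>w i. w \<in> set ws \<Longrightarrow> 0 < i \<Longrightarrow> ht k (take i w) \<ge> 1"
    and "0 < i" "ws \<noteq> []"
  shows "ht k (take i (concat ws)) \<ge> 1"
  using assms
proof (induction ws arbitrary: i)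
  case (Cons w ws)
  show ?case
  proof (cases "i \<le> length w \<or> ws = []")
    case True
    then show ?thesis using Cons.prems by auto
  next
    case False
    then have "ht k (take (i - length w) (concat ws)) \<ge> 1"
      using Cons.prems by (intro Cons.IH) auto
    moreover have "ht k w = 1" using Cons.prems by simp
    ultimately show ?thesis using False by simp
  qed
qed simp

lemma ht_post_prefix: "kary k t \<Longrightarrow> 0 < i \<Longrightarrow> ht k (take i (post t)) \<ge> 1"
proof (induction t arbitrary: i)
  case Leaf
  then show ?case by (cases i) auto
next
  case (Node ts)
  let ?c = "concat (map post ts)"
  show ?case
  proof (cases "i \<le> length ?c")
    case True
    have "ht k (take i ?c) \<ge> 1"
      using Node by (intro ht_concat_prefix) (auto simp: ht_post)
    then show ?thesis using True by simp
  next
    case False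
    then have "take i (post (Node ts)) = post (Node ts)" by simp
    then show ?thesis using ht_post[OF Node.prems(1)] by simp
  qed
qed

text \<open>One step of the machine that reads a postfix word with a stack of trees. The top of the
  stack is the end of the list, so that the stack spells the word read so far. A \<open>D\<close> read with
  fewer than \<open>k + 1\<close> trees on the stack collects all of them.\<close>

definition push :: "nat \<Rightarrow> step \<Rightarrow> tree list \<Rightarrow> tree list" where
  "push k s st =
     (case s of U \<Rightarrow> st @ [Leaf]
      | D \<Rightarrow> take (length st - Suc k) st @ [Node (drop (length st - Suc k) st)])"

lemma push_U [simp]: "push k U st = st @ [Leaf]"
  by (simp add: push_def)

lemma push_D [simp]:
  "push k D st = take (length st - Suc k) st @ [Node (drop (length st - Suc k) st)]"
  by (simp add: push_def)

lemma fold_push_concat_post: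
  assumes "\<And>t st. t \<in> set ts \<Longrightarrow> fold (push k) (post t) st = st @ [t]"
  shows "fold (push k) (concat (map post ts)) st = st @ ts"
  using assms by (induction ts arbitrary: st) simp_all

lemma fold_push_post: "kary k t \<Longrightarrow> fold (push k) (post t) st = st @ [t]"
proof (induction t arbitrary: st)
  case (Node ts)
  then have "fold (push k) (concat (map post ts)) st = st @ ts"
    by (intro fold_push_concat_post) auto
  then show ?case using Node.prems by simp
qed simp

lemma inj_on_post: "inj_on post {t. kary k t}"
proof (rule inj_onI)
  fix t t' assume "t \<in> {t. kary k t}" "t' \<in> {t. kary k t}" "post t = post t'"
  then have "kary k t" "kary k t'" "fold (push k) (post t) [] = fold (push k) (post t') []"
    by simp_all
  then show "t = t'" by (simp only: fold_push_post) simp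
qed

text \<open>On a word all of whose nonempty prefixes have positive height the stack never runs out of
  trees, and its size is the height.\<close>

lemma fold_push_prefix:
  assumes "\<And>i. 0 < i \<Longrightarrow> i \<le> length w \<Longrightarrow> ht k (take i w) \<ge> 1"
  shows "concat (map post (fold (push k) w [])) = w
         \<and> int (length (fold (push k) w [])) = ht k w
         \<and> (\<forall>t \<in> set (fold (push k) w []). kary k t)"
  using assms
proof (induction w rule: rev_induct)
  case (snoc s w)
  let ?st = "fold (push k) w []"
  have "ht k (take i w) \<ge> 1" if "0 < i" "i \<le> length w" for i
    using snoc.prems[of i] that by simp
  then have IH: "concat (map post ?st) = w" "int (length ?st) = ht k w" "\<forall>t \<in> set ?st. kary k t"
    using snoc.IH by blast+
  show ?case
  proof (cases s)
    case U
    then show ?thesis using IH by simp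
  next
    case D
    \<comment> \<open>The height after this down step is positive, so the stack holds enough trees.\<close>
    have "ht k w - int k \<ge> 1"
      using snoc.prems[of "Suc (length w)"] D by simp
    then have len: "Suc k \<le> length ?st" using IH(2) by linarith
    let ?m = "length ?st - Suc k"
    have "concat (map post (take ?m ?st)) @ concat (map post (drop ?m ?st)) = w"
      using IH(1) by (metis append_take_drop_id concat_append map_append)
    then show ?thesis using D IH len
      by (auto dest: in_set_takeD in_set_dropD)
  qed
qed simp

text \<open>The trees whose paths have down-size \<open>n\<close>.\<close>

definition kary_trees :: "nat \<Rightarrow> nat \<Rightarrow> tree set" where
  "kary_trees k n = {t. kary k t \<and> length (post t) = Suc ((k + 1) * n)}"

lemma post_eq_U_tl: "kary k t \<Longrightarrow> post t = U # tl (post t)"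
  by (metis hd_post list.collapse post_neq_Nil)

lemma bij_betw_tl_post: "bij_betw (\<lambda>t. tl (post t)) (kary_trees k n) (dyck_paths k n)"
  unfolding bij_betw_def
proof (intro conjI)
  show "inj_on (\<lambda>t. tl (post t)) (kary_trees k n)"
  proof (rule inj_onI)
    fix t t' assume *: "t \<in> kary_trees k n" "t' \<in> kary_trees k n" "tl (post t) = tl (post t')"
    then have "post t = post t'"
      using post_eq_U_tl[of k t] post_eq_U_tl[of k t'] by (simp add: kary_trees_def)
    then show "t = t'"
      using * inj_onD[OF inj_on_post[of k]] by (simp add: kary_trees_def)
  qed
  show "(\<lambda>t. tl (post t)) ` kary_trees k n = dyck_paths k n"
  proof (intro equalityI subsetI)
    fix P assume "P \<in> (\<lambda>t. tl (post t)) ` kary_trees k n"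
    then obtain t where t: "kary k t" "length (post t) = Suc ((k + 1) * n)" "P = tl (post t)"
      by (auto simp: kary_trees_def)
    then have p: "post t = U # P" using post_eq_U_tl by simp
    have "ht k (take i P) \<ge> 0" for i
      using ht_post_prefix[OF t(1), of "Suc i"] p by simp
    then show "P \<in> dyck_paths k n"
      using t(2) p ht_post[OF t(1)] by (simp add: dyck_paths_iff)
  next
    fix P assume P: "P \<in> dyck_paths k n"
    let ?st = "fold (push k) (U # P) []"
    have "ht k (take i (U # P)) \<ge> 1" if "0 < i" "i \<le> length (U # P)" for i
      using that P by (cases i) (auto simp: dyck_paths_iff)
    then have st: "concat (map post ?st) = U # P" "int (length ?st) = ht k (U # P)"
      "\<forall>t \<in> set ?st. kary k t"
      using fold_push_prefix by blast+
    then have "length ?st = 1" using P by (simp add: dyck_paths_iff)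
    then obtain t where "?st = [t]" by (metis One_nat_def length_0_conv length_Suc_conv)
    then have "post t = U # P" "kary k t" using st by auto
    then show "P \<in> (\<lambda>t. tl (post t)) ` kary_trees k n"
      using P by (intro image_eqI[of _ _ t]) (auto simp: kary_trees_def dyck_paths_iff)
  qed
qed

section \<open>The statistics on trees\<close>

text \<open>The number of all peaks of the path of \<open>t\<close>, the last one included, with height congruent to
  \<open>i\<close> modulo \<open>k\<close>. The initial \<open>U\<close> of \<open>post t\<close> raises every height by one; it forms no peak
  itself, as it is never followed by \<open>D\<close> if \<open>k \<ge> 1\<close> and \<open>t\<close> is \<open>kary k\<close>.\<close>

definition tree_pk :: "nat \<Rightarrow> int \<Rightarrow> tree \<Rightarrow> nat" where
  "tree_pk k i t = occ k U D (\<lambda>y. [y = i + 1] (mod int k)) (post t)"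

text \<open>The number of double descents of the path of \<open>t\<close>. Heights play no role here; the
  parameter \<open>k\<close> is only passed on to \<open>occ\<close>.\<close>

definition tree_dd :: "nat \<Rightarrow> tree \<Rightarrow> nat" where
  "tree_dd k t = occ k D D (\<lambda>_. True) (post t)"

lemma tree_pk_Leaf [simp]: "tree_pk k i Leaf = 0"
  by (simp add: tree_pk_def occ_Cons)

lemma tree_dd_Leaf [simp]: "tree_dd k Leaf = 0"
  by (simp add: tree_dd_def occ_Cons)

text \<open>A postfix word begins with \<open>U\<close>, so no pair ending in \<open>D\<close> straddles two of them.\<close>

lemma occ_concat_post:
  assumes "\<forall>t \<in> set ts. kary k t"
  shows "occ k a D R (concat (map post ts)) =
           (\<Sum>j<length ts. occ k a D (\<lambda>y. R (int j + y)) (post (ts ! j)))"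
  using assms
proof (induction ts arbitrary: R)
  case (Cons t ts)
  have "concat (map post ts) \<noteq> [] \<Longrightarrow> hd (concat (map post ts)) = U"
    using Cons.prems by (cases ts) (auto simp: hd_post)
  then have "occ k a D R (concat (map post (t # ts))) =
      occ k a D R (post t) + occ k a D (\<lambda>y. R (1 + y)) (concat (map post ts))"
    using Cons.prems by (auto simp: occ_append ht_post)
  also have "\<dots> = occ k a D R (post t)
      + (\<Sum>j<length ts. occ k a D (\<lambda>y. R (1 + (int j + y))) (post (ts ! j)))"
    using Cons by simp
  finally show ?case
    by (simp add: sum.lessThan_Suc_shift add.assoc del: sum.lessThan_Suc)
qed simp

lemma occ_post_Node:
  assumes "kary k (Node ts)"
  shows "occ k a D R (post (Node ts)) =
           (\<Sum>j<Suc k. occ k a D (\<lambda>y. R (int j + y)) (post (ts ! j)))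
             + of_bool (last (post (ts ! k)) = a \<and> R (int k + 1))"
proof -
  have "ts \<noteq> []" "last ts = ts ! k" "length ts = Suc k"
    using assms by (cases ts rule: rev_cases; auto simp: nth_append)+
  moreover have "ht k (concat (map post ts)) = int (length (map post ts))"
    using assms by (intro ht_concat) (auto simp: ht_post)
  ultimately show ?thesis using assms
    by (simp add: occ_append occ_Cons last_concat_post occ_concat_post add.commute
        del: sum.lessThan_Suc)
qed

lemma tree_dd_Node:
  assumes "kary k (Node ts)"
  shows "tree_dd k (Node ts) = (\<Sum>j<Suc k. tree_dd k (ts ! j)) + of_bool (ts ! k \<noteq> Leaf)"
  unfolding tree_dd_def occ_post_Node[OF assms] by (auto simp: last_post)

lemma tree_pk_Node:
  assumes "kary k (Node ts)"
  shows "tree_pk k i (Node ts) =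
           (\<Sum>j<Suc k. tree_pk k (i - int j) (ts ! j))
             + of_bool (ts ! k = Leaf \<and> [i = 0] (mod int k))"
proof -
  have "[int j + y = i + 1] (mod int k) \<longleftrightarrow> [y = i - int j + 1] (mod int k)" for j y
    by (simp add: cong_iff_dvd_diff algebra_simps)
  moreover have "[int k + 1 = i + 1] (mod int k) \<longleftrightarrow> [i = 0] (mod int k)"
  proof -
    have "[int k + 1 = i + 1] (mod int k) \<longleftrightarrow> int k dvd int k - i"
      by (simp add: cong_iff_dvd_diff)
    also have "\<dots> \<longleftrightarrow> int k dvd i"
      using dvd_diff_right_iff[of "int k" "int k" i] by simp
    finally show ?thesis by (simp add: cong_0_iff)
  qed
  ultimately show ?thesis
    unfolding tree_pk_def occ_post_Node[OF assms] by (simp add: last_post)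
qed

section \<open>The bijection\<close>

text \<open>The map carrying double descents to peaks of residue \<open>i\<close>: it exchanges the children with
  numbers \<open>i mod k\<close> and \<open>k\<close> of the root and recurs, the residue for the child placed in position
  \<open>j\<close> being \<open>i - j\<close> as this child starts at height \<open>j\<close>. The residue is a result argument so
  that the recursion on the children is primitive.\<close>

primrec psi :: "nat \<Rightarrow> tree \<Rightarrow> int \<Rightarrow> tree" where
  "psi k Leaf = (\<lambda>i. Leaf)"
| "psi k (Node ts) =
     (\<lambda>i. Node (map (\<lambda>j. (map (psi k) ts ! Transposition.transpose (nat (i mod int k)) k j) (i - int j))
                 [0..<Suc k]))"

lemma psi_eq_Leaf_iff [simp]: "psi k t i = Leaf \<longleftrightarrow> t = Leaf"
  by (cases t) simp_all

context
  fixes k :: nat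
  assumes k_pos: "k \<ge> 1"
begin

lemma transpose_less:
  assumes "j < Suc k"
  shows "Transposition.transpose (nat (i mod int k)) k j < Suc k"
proof -
  have "nat (i mod int k) < k" using k_pos by (simp add: nat_less_iff)
  then show ?thesis using assms by (simp add: Transposition.transpose_def)
qed

lemma sum_transpose:
  fixes f :: "nat \<Rightarrow> nat"
  shows "(\<Sum>j<Suc k. f (Transposition.transpose (nat (i mod int k)) k j)) = (\<Sum>j<Suc k. f j)"
proof (rule sum.reindex_bij_betw)
  let ?s = "Transposition.transpose (nat (i mod int k)) k"
  show "bij_betw ?s {..<Suc k} {..<Suc k}"
    by (rule bij_betw_byWitness[of _ ?s]) (auto dest: transpose_less)
qed

lemma psi_Node:
  assumes "length ts = Suc k"
  shows "psi k (Node ts) i =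
     Node (map (\<lambda>j. psi k (ts ! Transposition.transpose (nat (i mod int k)) k j) (i - int j))
            [0..<Suc k])"
  by (simp add: assms transpose_less del: upt_Suc)

lemma kary_psi: "kary k t \<Longrightarrow> kary k (psi k t i)"
proof (induction t arbitrary: i)
  case (Node ts)
  then have "kary k (psi k (ts ! Transposition.transpose (nat (i mod int k)) k j) (i - int j))"
    if "j < Suc k" for j
    using transpose_less[OF that] by simp
  then show ?case using Node.prems by (subst psi_Node) (auto simp del: upt_Suc)
qed simp

lemma inj_psi: "kary k t \<Longrightarrow> kary k t' \<Longrightarrow> psi k t i = psi k t' i \<Longrightarrow> t = t'"
proof (induction t arbitrary: t' i)
  case Leaf
  then show ?case by (metis psi_eq_Leaf_iff)
next
  case (Node ts)
  then obtain ts' where t': "t' = Node ts'"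
    by (metis psi_eq_Leaf_iff tree.exhaust)
  let ?s = "Transposition.transpose (nat (i mod int k)) k"
  have len: "length ts = Suc k" "length ts' = Suc k" using Node.prems t' by auto
  have eq: "psi k (ts ! ?s j) (i - int j) = psi k (ts' ! ?s j) (i - int j)" if "j < Suc k" for j
    using Node.prems(3) that unfolding t' by (simp only: psi_Node len) (simp del: upt_Suc)
  have "ts ! m = ts' ! m" if "m < Suc k" for m
  proof (rule Node.IH)
    show "psi k (ts ! m) (i - int (?s m)) = psi k (ts' ! m) (i - int (?s m))"
      using eq[OF transpose_less[OF that, of i]] by (simp only: transpose_involutory)
  qed (use Node.prems(1,2) len that t' in simp_all)
  then show ?case unfolding t' using len by (simp add: list_eq_iff_nth_eq)
qed

lemma length_post_Node:
  "length ts = Suc k \<Longrightarrow> length (post (Node ts)) = Suc (\<Sum>j<Suc k. length (post (ts ! j)))"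
  by (simp add: length_concat sum_list_sum_nth atLeast0LessThan
      del: sum.lessThan_Suc sum.op_ivl_Suc)

lemma length_post_psi: "kary k t \<Longrightarrow> length (post (psi k t i)) = length (post t)"
proof (induction t arbitrary: i)
  case (Node ts)
  let ?s = "Transposition.transpose (nat (i mod int k)) k"
  have len: "length ts = Suc k" using Node.prems by simp
  have "length (post (psi k (Node ts) i)) =
      Suc (\<Sum>j<Suc k. length (post (psi k (ts ! ?s j) (i - int j))))"
    by (subst psi_Node[OF len], subst length_post_Node)
      (simp_all del: upt_Suc sum.lessThan_Suc)
  also have "(\<Sum>j<Suc k. length (post (psi k (ts ! ?s j) (i - int j)))) =
      (\<Sum>j<Suc k. length (post (ts ! ?s j)))"
    using Node len transpose_less by (intro sum.cong) auto
  also have "\<dots> = (\<Sum>j<Suc k. length (post (ts ! j)))"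
    by (rule sum_transpose)
  finally show ?case using length_post_Node[OF len] by simp
qed simp

text \<open>The parameter \<open>i - j\<close> of a child vanishes modulo \<open>k\<close> in position \<open>j = i mod k\<close>, which receives
  the former last child, and, if \<open>i\<close> is divisible by \<open>k\<close>, also in position \<open>k\<close>. In the latter case
  the child in position \<open>k\<close> accounts for one peak in any event: the additional one given by the
  induction hypothesis if it is not a leaf, and the one formed with the final \<open>D\<close> if it is.\<close>

lemma tree_pk_psi:
  "kary k t \<Longrightarrow> tree_pk k i (psi k t i) = tree_dd k t + of_bool ([i = 0] (mod int k) \<and> t \<noteq> Leaf)"
proof (induction t arbitrary: i)
  case (Node ts)
  define i0 where "i0 = nat (i mod int k)"
  let ?s = "Transposition.transpose i0 k"
  let ?rs = "map (\<lambda>j. psi k (ts ! ?s j) (i - int j)) [0..<Suc k]"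
  have len: "length ts = Suc k" using Node.prems by simp
  have i0: "i0 < k" "int i0 = i mod int k" using k_pos by (simp_all add: i0_def nat_less_iff)
  have psi: "psi k (Node ts) i = Node ?rs" using psi_Node[OF len] unfolding i0_def .
  have nth: "?rs ! j = psi k (ts ! ?s j) (i - int j)" if "j < Suc k" for j
    using that by (simp del: upt_Suc)
  have cong_less: "[i - int j = 0] (mod int k) \<longleftrightarrow> j = i0" if "j < k" for j
  proof -
    have "[i - int j = 0] (mod int k) \<longleftrightarrow> [i = int j] (mod int k)"
      by (simp add: cong_iff_dvd_diff)
    also have "\<dots> \<longleftrightarrow> int i0 = int j" using that by (simp add: cong_def i0)
    finally show ?thesis by auto
  qed
  have cong_k: "[i - int k = 0] (mod int k) \<longleftrightarrow> [i = 0] (mod int k)"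
    by (simp add: cong_def)
  have cong_0: "[i = 0] (mod int k) \<longleftrightarrow> i0 = 0"
    using cong_less[of 0] k_pos by auto
  have "tree_pk k i (psi k (Node ts) i) =
      (\<Sum>j<Suc k. tree_pk k (i - int j) (psi k (ts ! ?s j) (i - int j)))
        + of_bool (ts ! i0 = Leaf \<and> [i = 0] (mod int k))"
    using kary_psi[OF Node.prems, of i] unfolding psi
    by (subst tree_pk_Node) (simp_all add: nth del: upt_Suc sum.lessThan_Suc)
  also have "(\<Sum>j<Suc k. tree_pk k (i - int j) (psi k (ts ! ?s j) (i - int j))) =
      (\<Sum>j<Suc k. tree_dd k (ts ! ?s j)
         + of_bool ([i - int j = 0] (mod int k) \<and> ts ! ?s j \<noteq> Leaf))"
    using Node len transpose_less[of _ i] by (intro sum.cong) (auto simp: i0_def)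
  also have "\<dots> = (\<Sum>j<Suc k. tree_dd k (ts ! j))
      + (\<Sum>j<Suc k. of_bool ([i - int j = 0] (mod int k) \<and> ts ! ?s j \<noteq> Leaf))"
    using sum_transpose[of "\<lambda>j. tree_dd k (ts ! j)" i] unfolding sum.distrib i0_def by simp
  also have "(\<Sum>j<Suc k. of_bool ([i - int j = 0] (mod int k) \<and> ts ! ?s j \<noteq> Leaf)) =
      (\<Sum>j<k. if j = i0 then of_bool (ts ! k \<noteq> Leaf) else 0 :: nat)
        + of_bool ([i = 0] (mod int k) \<and> ts ! i0 \<noteq> Leaf)"
  proof -
    have "(\<Sum>j<k. of_bool ([i - int j = 0] (mod int k) \<and> ts ! ?s j \<noteq> Leaf)) =
        (\<Sum>j<k. if j = i0 then of_bool (ts ! k \<noteq> Leaf) else 0 :: nat)"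
      using cong_less by (intro sum.cong) auto
    then show ?thesis using cong_k by simp
  qed
  also have "(\<Sum>j<k. if j = i0 then of_bool (ts ! k \<noteq> Leaf) else 0 :: nat)
      = of_bool (ts ! k \<noteq> Leaf)"
    using i0 by simp
  finally show ?case
    unfolding tree_dd_Node[OF Node.prems] by auto
qed simp

lemma bij_betw_psi: "bij_betw (\<lambda>t. psi k t i) (kary_trees k n) (kary_trees k n)"
proof -
  have "finite (kary_trees k n)"
    using bij_betw_finite[OF bij_betw_tl_post] finite_dyck_paths by blast
  moreover have inj: "inj_on (\<lambda>t. psi k t i) (kary_trees k n)"
    using inj_psi by (auto simp: inj_on_def kary_trees_def)
  moreover have "(\<lambda>t. psi k t i) ` kary_trees k n \<subseteq> kary_trees k n"
    using kary_psi length_post_psi by (auto simp: kary_trees_def)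
  ultimately show ?thesis
    unfolding bij_betw_def using endo_inj_surj by blast
qed

section \<open>Transfer to paths\<close>

text \<open>Only down steps follow the last peak of a path, so its height is a multiple of \<open>k\<close>.\<close>

lemma pk_eq_occ_minus:
  assumes P: "P \<in> dyck_paths k n" and "i < k"
  shows "pk k i P = occ k U D (\<lambda>y. [y = int i] (mod int k)) P - of_bool (i = 0 \<and> P \<noteq> [])"
proof (cases "P = []")
  case True
  then show ?thesis by (simp add: pk_def peaks_def)
next
  case False
  have ht: "ht k P = 0" "\<And>j. j \<le> length P \<Longrightarrow> ht k (take j P) \<ge> 0"
    using P by (auto simp: dyck_paths_iff)
  have "hd P = U"
  proof (rule ccontr)
    assume "hd P \<noteq> U"
    then obtain w where "P = D # w" using False by (metis list.collapse step.exhaust)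
    then show False using ht(2)[of 1] k_pos by simp
  qed
  \<comment> \<open>Split at the last up step.\<close>
  then have "U \<in> set P" using False hd_in_set by metis
  then obtain v w where P_vw: "P = v @ U # w" and "U \<notin> set w"
    by (metis split_list_last)
  then have "\<forall>x \<in> set w. x = D" by (metis step.exhaust)
  then obtain m where w: "w = replicate m D" by (metis replicate_length_same)
  have htv: "ht k (v @ [U]) = int (k * m)"
    using ht(1) unfolding P_vw w by (simp add: ht_replicate_D)
  have "m \<noteq> 0"
    using ht(1) ht(2)[of "length v"] unfolding P_vw w by (intro notI) simp
  then have last: "length v \<in> peaks P" and le: "\<And>p. p \<in> peaks P \<Longrightarrow> p \<le> length v"
    unfolding P_vw w peaks_def
    by (auto simp: nth_append nth_Cons split: nat.splits if_splits)
  \<comment> \<open>The last peak is at position \<open>length v\<close>; the others are exactly those with a later peak.\<close>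
  have ph: "peak_height k P p = ht k (take (Suc p) P)" for p
    by (simp add: peak_height_def vertex_def ht_def)
  let ?A = "{p \<in> peaks P. [ht k (take (Suc p) P) = int i] (mod int k)}"
  have "{p \<in> peaks P. (\<exists>p' \<in> peaks P. p < p') \<and> [peak_height k P p = int i] (mod int k)}
      = ?A - {length v}"
    using last le unfolding ph by (auto simp: nat_less_le) (metis le_less_trans nat_less_le)+
  moreover have "length v \<in> ?A \<longleftrightarrow> i = 0"
  proof -
    have "take (Suc (length v)) P = v @ [U]" by (simp add: P_vw)
    then show ?thesis using last htv \<open>i < k\<close> by (simp add: cong_def)
  qed
  moreover have "finite ?A"
    by (rule finite_subset[of _ "{..<length P}"]) (auto simp: peaks_def)
  moreover have "occ k U D (\<lambda>y. [y = int i] (mod int k)) P = card ?A"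
    unfolding occ_def peaks_def by (rule arg_cong[of _ _ card]) auto
  ultimately show ?thesis
    unfolding pk_def using False by (simp add: card_Diff_singleton_if)
qed

lemma occ_tl_post:
  assumes "kary k t"
  shows "occ k a D R (post t) = occ k a D (\<lambda>y. R (1 + y)) (tl (post t))"
proof -
  have "tl (post t) = [] \<or> hd (tl (post t)) = U"
  proof (rule ccontr)
    assume "\<not> ?thesis"
    then obtain w where "tl (post t) = D # w" by (metis list.collapse step.exhaust)
    then have "post t = U # D # w" using post_eq_U_tl[OF assms] by simp
    then show False using ht_post_prefix[OF assms, of 2] k_pos by simp
  qed
  then show ?thesis
    by (subst post_eq_U_tl[OF assms]) (auto simp: occ_Cons)
qed

lemma dd_tl_post: "kary k t \<Longrightarrow> dd (tl (post t)) = tree_dd k t"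
  by (simp add: dd_eq_occ[of _ k] tree_dd_def occ_tl_post)

lemma pk_tl_post_psi:
  assumes "t \<in> kary_trees k n" and "i < k"
  shows "pk k i (tl (post (psi k t (int i)))) = dd (tl (post t))"
proof -
  let ?t = "psi k t (int i)"
  have t: "kary k t" using assms(1) by (simp add: kary_trees_def)
  have "?t \<in> kary_trees k n" using bij_betwE[OF bij_betw_psi] assms(1) by blast
  then have "tl (post ?t) \<in> dyck_paths k n" using bij_betwE[OF bij_betw_tl_post] by blast
  then have "pk k i (tl (post ?t)) =
      occ k U D (\<lambda>y. [y = int i] (mod int k)) (tl (post ?t)) - of_bool (i = 0 \<and> tl (post ?t) \<noteq> [])"
    by (rule pk_eq_occ_minus[OF _ assms(2)])
  also have "occ k U D (\<lambda>y. [y = int i] (mod int k)) (tl (post ?t)) = tree_pk k (int i) ?t"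
    unfolding tree_pk_def occ_tl_post[OF kary_psi[OF t]]
    by (simp add: cong_iff_dvd_diff)
  also have "tree_pk k (int i) ?t = tree_dd k t + of_bool (i = 0 \<and> t \<noteq> Leaf)"
    using tree_pk_psi[OF t] assms(2) by (simp add: cong_def)
  also have "tl (post ?t) \<noteq> [] \<longleftrightarrow> t \<noteq> Leaf"
  proof -
    have "tl (post ?t) = [] \<longleftrightarrow> post ?t = post Leaf"
      using post_eq_U_tl[OF kary_psi[OF t], of "int i"] by auto
    also have "\<dots> \<longleftrightarrow> ?t = Leaf"
      using inj_onD[OF inj_on_post[of k]] kary_psi[OF t] by fastforce
    finally show ?thesis by simp
  qed
  finally show ?thesis using dd_tl_post[OF t] by simp
qed

lemma card_pk_eq_card_dd:
  assumes "i < k"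
  shows "card {P \<in> dyck_paths k n. pk k i P = r} = card {P \<in> dyck_paths k n. dd P = r}"
proof -
  have transfer: "card {b \<in> B. Q b} = card {a \<in> A. Q (f a)}"
    if "bij_betw f A B" for f :: "tree \<Rightarrow> 'b" and A B Q
  proof -
    have "bij_betw f {a \<in> A. Q (f a)} {b \<in> B. Q b}"
      using that by (auto simp: bij_betw_def inj_on_def)
    then show ?thesis by (simp add: bij_betw_same_card)
  qed
  let ?g = "\<lambda>t. tl (post t)"
  have "card {P \<in> dyck_paths k n. pk k i P = r} =
      card {t \<in> kary_trees k n. pk k i (?g (psi k t (int i))) = r}"
    using transfer[OF bij_betw_trans[OF bij_betw_psi[of "int i"] bij_betw_tl_post]]
    by (simp add: o_def)
  also have "\<dots> = card {t \<in> kary_trees k n. dd (?g t) = r}"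
    using pk_tl_post_psi[OF _ assms] by (intro arg_cong[of _ _ card]) auto
  also have "\<dots> = card {P \<in> dyck_paths k n. dd P = r}"
    using transfer[OF bij_betw_tl_post] by simp
  finally show ?thesis .
qed

end

theorem corollary2p9:
  fixes k n :: nat
  assumes "k \<ge> 1"
  shows "\<forall>r :: nat. \<forall>st \<in> insert dd (pk k ` {0..k - 1}). \<forall>st' \<in> insert dd (pk k ` {0..k - 1}).
           card {P \<in> dyck_paths k n. st P = r} = card {P \<in> dyck_paths k n. st' P = r}"
proof -
  have eq_dd: "card {P \<in> dyck_paths k n. st P = r} = card {P \<in> dyck_paths k n. dd P = r}"
    if "st \<in> insert dd (pk k ` {0..k - 1})" for st r
    using that card_pk_eq_card_dd[OF assms] assms by auto
  show ?thesis
    by (intro allI ballI) (rule trans[OF eq_dd sym[OF eq_dd]])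
qed

end
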